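(* Let $G$ be a finite group generated by a set $S$. Then there exists a simplicial surface $X_{G,S}$ such that $\mathrm{Aut}(X_{G,S})\cong G$.
   Context: A (closed) simplicial surface $(X,<)$ is a countable set $X$ partitioned into non-empty sets $X_0$ (vertices), $X_1$ (edges), $X_2$ (faces), together with a relation $<$ (incidence), a subset of $(X_0\times X_1)\cup(X_1\times X_2)\cup(X_0\times X_2)$, such that: (1) for each edge $e\in X_1$ there are exactly two vertices $V\in X_0$ with $V<e$; (2) for each face $F\in X_2$ there are exactly three edges $e\in X_1$ with $e<F$ and exactly three vertices $V\in X_0$ with $V<F$, and each of these three vertices is incident to exactly two of these three edges; (3) for each edge $e\in X_1$ there are exactly two faces $F\in X_2$ with $e<F$; (4) (umbrella condition) for each vertex $V\in X_0$ the number $n=\deg(V)$ of faces $F\in X_2$ with $V<F$ satisfies $3\le \deg(V)<\infty$, and these faces can be arranged in a sequence $(F_1,\dots,F_n)$ such that, with $F_{n+1}=F_1$, the faces $F_i$ and $F_{i+1}$ share a common edge $e_i$ with $V<e_i$ for $i=1,\dots,n$. A homomorphism $\pi:X\to Y$ of simplicial surfaces is a map such that $A<_X B$ implies $\pi(A)<_Y\pi(B)$, and such that for every face $F$ the restriction of $\pi$ to the vertices and edges incident to $F$ is an isomorphism onto the set of vertices and edges incident to $\pi(F)$. $\mathrm{Aut}(X)$ is the group of automorphisms of $X$, i.e. invertible homomorphisms $X\to X$ (equivalently, permutations of $X$ preserving each of $X_0,X_1,X_2$ and preserving the incidence relation in both directions). *)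

theory Defs
  imports "HOL-Library.Countable_Set" "HOL-Algebra.Bij" "HOL-Algebra.Generated_Groups"
begin

record 'a incidence_structure =
  vertices :: "'a set"
  edges :: "'a set"
  faces :: "'a set"
  incidence :: "('a \<times> 'a) set"

definition elements :: "'a incidence_structure \<Rightarrow> 'a set" where
  "elements X = vertices X \<union> edges X \<union> faces X"

abbreviation incident :: "'a \<Rightarrow> 'a incidence_structure \<Rightarrow> 'a \<Rightarrow> bool"
    (\<open>(_ \<prec>\<^bsub>_\<^esub> _)\<close> [51, 0, 51] 50) where
  "A \<prec>\<^bsub>X\<^esub> B \<equiv> (A, B) \<in> incidence X"

definition faces_at :: "'a incidence_structure \<Rightarrow> 'a \<Rightarrow> 'a set" where
  "faces_at X V = {F \<in> faces X. V \<prec>\<^bsub>X\<^esub> F}"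

text \<open>The list \<open>Fs\<close> enumerates the faces at \<open>V\<close> without repetition; indices are
  read cyclically, so that the last face is followed by the first one.\<close>

definition umbrella :: "'a incidence_structure \<Rightarrow> 'a \<Rightarrow> 'a list \<Rightarrow> bool" where
  "umbrella X V Fs \<longleftrightarrow> distinct Fs \<and> set Fs = faces_at X V \<and>
     (\<forall>i<length Fs. \<exists>e\<in>edges X.
        V \<prec>\<^bsub>X\<^esub> e \<and> e \<prec>\<^bsub>X\<^esub> Fs ! i \<and> e \<prec>\<^bsub>X\<^esub> Fs ! (Suc i mod length Fs))"

locale simplicial_surface =
  fixes X :: "'a incidence_structure"
  assumes countable_elements: "countable (elements X)"
    and nonempty: "vertices X \<noteq> {}" "edges X \<noteq> {}" "faces X \<noteq> {}"
    and disjoint: "vertices X \<inter> edges X = {}" "vertices X \<inter> faces X = {}"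
      "edges X \<inter> faces X = {}"
    and incidence_subset:
      "incidence X \<subseteq> vertices X \<times> edges X \<union> edges X \<times> faces X \<union> vertices X \<times> faces X"
    and edge_vertices: "e \<in> edges X \<Longrightarrow> card {V \<in> vertices X. V \<prec>\<^bsub>X\<^esub> e} = 2"
    and face_edges: "F \<in> faces X \<Longrightarrow> card {e \<in> edges X. e \<prec>\<^bsub>X\<^esub> F} = 3"
    and face_vertices: "F \<in> faces X \<Longrightarrow> card {V \<in> vertices X. V \<prec>\<^bsub>X\<^esub> F} = 3"
    and face_corners: "F \<in> faces X \<Longrightarrow> V \<in> vertices X \<Longrightarrow> V \<prec>\<^bsub>X\<^esub> F \<Longrightarrow>
      card {e \<in> edges X. e \<prec>\<^bsub>X\<^esub> F \<and> V \<prec>\<^bsub>X\<^esub> e} = 2"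
    and edge_faces: "e \<in> edges X \<Longrightarrow> card {F \<in> faces X. e \<prec>\<^bsub>X\<^esub> F} = 2"
    and degree: "V \<in> vertices X \<Longrightarrow> finite (faces_at X V) \<and> 3 \<le> card (faces_at X V)"
    and umbrella_condition: "V \<in> vertices X \<Longrightarrow> \<exists>Fs. umbrella X V Fs"

definition boundary :: "'a incidence_structure \<Rightarrow> 'a \<Rightarrow> 'a set" where
  "boundary X F = {A \<in> vertices X \<union> edges X. A \<prec>\<^bsub>X\<^esub> F}"

text \<open>Every vertex of \<open>boundary X F\<close> lies on an edge of \<open>boundary X F\<close>, so the bijection
  below sends vertices to vertices and edges to edges.\<close>

definition surface_hom ::
    "'a incidence_structure \<Rightarrow> 'b incidence_structure \<Rightarrow> ('a \<Rightarrow> 'b) set" where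
  "surface_hom X Y = {\<pi>. \<pi> \<in> elements X \<rightarrow> elements Y \<and>
     (\<forall>A B. A \<prec>\<^bsub>X\<^esub> B \<longrightarrow> \<pi> A \<prec>\<^bsub>Y\<^esub> \<pi> B) \<and>
     (\<forall>F\<in>faces X. bij_betw \<pi> (boundary X F) (boundary Y (\<pi> F)) \<and>
        (\<forall>A\<in>boundary X F. \<forall>B\<in>boundary X F. A \<prec>\<^bsub>X\<^esub> B \<longleftrightarrow> \<pi> A \<prec>\<^bsub>Y\<^esub> \<pi> B))}"

text \<open>Maps are taken extensional, so that automorphisms agreeing on the elements of \<open>X\<close>
  are equal.\<close>

definition automorphisms :: "'a incidence_structure \<Rightarrow> ('a \<Rightarrow> 'a) set" where
  "automorphisms X = {\<pi> \<in> extensional (elements X) \<inter> surface_hom X X.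
     \<exists>\<sigma>\<in>surface_hom X X. \<forall>A\<in>elements X. \<sigma> (\<pi> A) = A \<and> \<pi> (\<sigma> A) = A}"

definition Aut :: "'a incidence_structure \<Rightarrow> ('a \<Rightarrow> 'a) monoid" where
  "Aut X = (BijGroup (elements X))\<lparr>carrier := automorphisms X\<rparr>"

end

theory Submission
  imports Defs
begin

text \<open>Triangles with edges coloured red, green and blue are glued along edges of equal colour.
  Such a gluing consists of three involutions on the set of triangles; the vertices of
  the resulting surface are the orbits under two of the three involutions, and the length of
  such an orbit is the degree of the vertex.

  A connected surface is rigid: an automorphism that fixes one triangle together with its
  corners fixes the neighbouring triangles in the same way, and hence everything
  (\<open>rigidity\<close>). If \<open>G\<close> acts freely on the triangles and respects the gluing, the automorphism
  group is therefore \<open>G\<close> as soon as every automorphism moves some base triangle like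
  an element of \<open>G\<close> does. This can be enforced by degrees: it suffices that the corners of the
  base triangle have three distinct degrees and that only its translates under \<open>G\<close> have
  corners with this set of degrees (\<open>Aut_iso\<close>).

  Such a gluing is obtained from voltages. For each \<open>h \<in> G\<close> there is one copy of a fixed finite
  pattern of triangles, and crossing certain blue edges replaces \<open>h\<close> by \<open>h \<otimes> g\<close> for a generator
  \<open>g\<close>; left multiplication commutes with this, and the surface is connected because
  the generators reach every copy (\<open>connected\<close>). The voltages make many of the degrees depend on
  the orders of elements of \<open>G\<close>. The pattern therefore contains a part without voltages
  in which all triangles around a blue corner of degree \<open>4\<close> have known degrees, and exactly one
  of these triangles has the degrees \<open>8\<close>, \<open>6\<close>, \<open>4\<close>; all other blue corners have degree at
  least \<open>9\<close>, so this triangle is recognised (\<open>base_recognised\<close>).\<close>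

section \<open>Triangles glued along coloured edges\<close>

datatype colour = Red | Green | Blue

lemma UNIV_colour: "UNIV = {Red, Green, Blue}"
  using colour.exhaust by auto

instance colour :: finite
  by standard (simp add: UNIV_colour)

lemma card_UNIV_colour: "card (UNIV :: colour set) = 3"
  by (simp add: UNIV_colour)

lemma card_other_colours: "card {i :: colour. i \<noteq> k} = 2"
proof -
  have "{i. i \<noteq> k} = UNIV - {k}"
    by auto
  then show ?thesis
    by (simp add: card_UNIV_colour card_Diff_singleton)
qed

lemma other_colours:
  obtains i j :: colour where "i \<noteq> j" "i \<noteq> k" "j \<noteq> k" "\<forall>c. c \<noteq> k \<longrightarrow> c = i \<or> c = j"
proof -
  obtain i j where "{i. i \<noteq> k} = {i, j}" "i \<noteq> j"
    using card_other_colours[of k] by (auto simp: card_2_iff)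
  then show ?thesis
    using that[of i j] by blast
qed

text \<open>A set of triangles, each with one edge of every colour; \<open>\<sigma> i t\<close> is the triangle glued to
\<open>t\<close> along its edge of colour \<open>i\<close>. The map \<open>side\<close> is a two-colouring of the triangles in which neighbours
always differ. It keeps the \<open>\<sigma> i\<close> free of fixed points, and it
makes every alternating walk around a vertex close up only after an even number of steps.
The last assumption excludes vertices of degree two.\<close>

locale coloured_gluing =
  fixes T :: "'f set" and \<sigma> :: "colour \<Rightarrow> 'f \<Rightarrow> 'f" and side :: "'f \<Rightarrow> bool"
  assumes finite_T: "finite T" and T_nonempty: "T \<noteq> {}"
    and glue_in: "t \<in> T \<Longrightarrow> \<sigma> i t \<in> T"
    and glue_glue: "t \<in> T \<Longrightarrow> \<sigma> i (\<sigma> i t) = t"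
    and side_glue: "t \<in> T \<Longrightarrow> side (\<sigma> i t) \<longleftrightarrow> \<not> side t"
    and glue_neq: "t \<in> T \<Longrightarrow> i \<noteq> j \<Longrightarrow> \<sigma> i t \<noteq> \<sigma> j t"
begin

text \<open>A corner of a triangle gets the colour of the edge opposite to it. Going around the corner
of colour \<open>k\<close> crosses the edges of the other two colours, so \<open>orb k t\<close> collects the triangles
that meet in the \<open>k\<close>-corner of \<open>t\<close>; its cardinality is the degree of that vertex.\<close>

definition step_rel :: "colour \<Rightarrow> ('f \<times> 'f) set" where
  "step_rel k = {(t, \<sigma> i t) | i t. i \<noteq> k \<and> t \<in> T}"

definition orb :: "colour \<Rightarrow> 'f \<Rightarrow> 'f set" where
  "orb k t = {u. (t, u) \<in> (step_rel k)\<^sup>*}"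

lemma glue_fixfree: "t \<in> T \<Longrightarrow> \<sigma> i t \<noteq> t"
  using side_glue[of t i] by auto

lemma sym_step_rel: "sym (step_rel k)"
proof (rule symI)
  fix t u assume "(t, u) \<in> step_rel k"
  then obtain i where "i \<noteq> k" "t \<in> T" "u = \<sigma> i t"
    by (auto simp: step_rel_def)
  then show "(u, t) \<in> step_rel k"
    by (auto simp: step_rel_def glue_in glue_glue intro!: exI[of _ u] exI[of _ i])
qed

lemma orb_refl [simp]: "t \<in> orb k t"
  by (simp add: orb_def)

lemma orb_sym: "u \<in> orb k t \<Longrightarrow> t \<in> orb k u"
  using symD[OF sym_rtrancl[OF sym_step_rel]] by (simp add: orb_def)

lemma orb_trans: "u \<in> orb k t \<Longrightarrow> v \<in> orb k u \<Longrightarrow> v \<in> orb k t"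
  unfolding orb_def by auto

lemma orb_eq: "u \<in> orb k t \<Longrightarrow> orb k u = orb k t"
  using orb_trans[of u k t] orb_trans[of t k u] orb_sym[of u k t] by auto

lemma orb_step: "u \<in> orb k t \<Longrightarrow> u \<in> T \<Longrightarrow> i \<noteq> k \<Longrightarrow> \<sigma> i u \<in> orb k t"
  unfolding orb_def step_rel_def by (auto intro: rtrancl_into_rtrancl)

lemma orb_closed:
  assumes "t \<in> A" and "\<And>u i. u \<in> A \<Longrightarrow> u \<in> T \<Longrightarrow> i \<noteq> k \<Longrightarrow> \<sigma> i u \<in> A"
  shows "orb k t \<subseteq> A"
proof
  fix u assume "u \<in> orb k t"
  then have "(t, u) \<in> (step_rel k)\<^sup>*"
    by (simp add: orb_def)
  then show "u \<in> A"
    by induction (use assms in \<open>auto simp: step_rel_def\<close>)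
qed

lemma orb_subset: "t \<in> T \<Longrightarrow> orb k t \<subseteq> T"
  by (rule orb_closed) (auto intro: glue_in)

lemma finite_orb: "t \<in> T \<Longrightarrow> finite (orb k t)"
  using orb_subset finite_T finite_subset by blast

lemma card_orb_ge_3:
  assumes "t \<in> T"
  shows "3 \<le> card (orb k t)"
proof -
  obtain i j where ij: "i \<noteq> j" "i \<noteq> k" "j \<noteq> k"
    using other_colours[of k] by blast
  have "{t, \<sigma> i t, \<sigma> j t} \<subseteq> orb k t"
    using orb_step[OF orb_refl assms] ij by simp
  moreover have "card {t, \<sigma> i t, \<sigma> j t} = 3"
    using glue_fixfree[OF assms, of i] glue_fixfree[OF assms, of j] glue_neq[OF assms ij(1)]
    by auto
  ultimately show ?thesis
    using finite_orb[OF assms] card_mono by metis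
qed

definition connection :: "('f \<times> 'f) set" where
  "connection = {(t, \<sigma> i t) | i t. t \<in> T}\<^sup>*"

lemma sym_connection: "sym connection"
proof -
  have "sym {(t, \<sigma> i t) | i t. t \<in> T}"
  proof (rule symI)
    fix t u assume "(t, u) \<in> {(t, \<sigma> i t) | i t. t \<in> T}"
    then obtain i where "t \<in> T" "u = \<sigma> i t"
      by auto
    then show "(u, t) \<in> {(t, \<sigma> i t) | i t. t \<in> T}"
      by (auto simp: glue_in glue_glue intro!: exI[of _ u] exI[of _ i])
  qed
  then show ?thesis
    unfolding connection_def by (rule sym_rtrancl)
qed

lemma connection_step: "t \<in> T \<Longrightarrow> (t, \<sigma> i t) \<in> connection"
  unfolding connection_def by (rule r_into_rtrancl) auto

lemma connection_trans: "(t, u) \<in> connection \<Longrightarrow> (u, v) \<in> connection \<Longrightarrow> (t, v) \<in> connection"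
  unfolding connection_def by (rule rtrancl_trans)

lemma orb_connection:
  assumes "u \<in> orb k t"
  shows "(t, u) \<in> connection"
proof -
  have "step_rel k \<subseteq> {(t, \<sigma> i t) | i t. t \<in> T}"
    by (auto simp: step_rel_def)
  then show ?thesis
    using assms rtrancl_mono unfolding orb_def connection_def by blast
qed

primrec walk :: "colour \<Rightarrow> colour \<Rightarrow> 'f \<Rightarrow> nat \<Rightarrow> 'f" where
  "walk i j t 0 = t"
| "walk i j t (Suc l) = \<sigma> (if even l then i else j) (walk i j t l)"

lemma walk_numeral [simp]:
  "walk i j t (numeral n) =
     \<sigma> (if even (pred_numeral n) then i else j) (walk i j t (pred_numeral n))"
  by (simp add: numeral_eq_Suc)

lemma walk_in: "t \<in> T \<Longrightarrow> walk i j t l \<in> T"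
  by (induction l) (auto intro: glue_in)

lemma side_walk: "t \<in> T \<Longrightarrow> side (walk i j t l) \<longleftrightarrow> (side t \<longleftrightarrow> even l)"
  by (induction l) (auto simp: side_glue walk_in)

lemma walk_back:
  "t \<in> T \<Longrightarrow> walk i j t l = \<sigma> (if even l then i else j) (walk i j t (Suc l))"
  by (simp add: glue_glue walk_in)

text \<open>Each step is an involution, so two walks that meet can be rolled back together; the sides
of the triangles guarantee that both undo the same colour.\<close>

lemma walk_cancel:
  assumes "t \<in> T" and "walk i j t l = walk i j t (l + d)"
  shows "walk i j t d = t"
  using assms(2)
proof (induction l)
  case (Suc l)
  have "(side t \<longleftrightarrow> even (Suc l)) = (side t \<longleftrightarrow> even (Suc l + d))"
    using Suc.prems side_walk[OF assms(1)] by metis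
  then have "even l \<longleftrightarrow> even (l + d)"
    by (cases "side t"; cases "even l"; cases "even d") simp_all
  then have "walk i j t l = walk i j t (l + d)"
    using Suc.prems walk_back[OF assms(1), of i j l] walk_back[OF assms(1), of i j "l + d"]
    by (metis add_Suc)
  then show ?case
    by (rule Suc.IH)
qed simp

text \<open>A closed walk stays closed under both involutions: one of them leads to the next position,
the other one to the previous position. This computes degrees by following a walk.\<close>

lemma orb_eq_walk:
  assumes t: "t \<in> T" and k: "i \<noteq> k" "j \<noteq> k" "\<forall>c. c \<noteq> k \<longrightarrow> c = i \<or> c = j"
    and N: "0 < N" "walk i j t N = t"
  shows "orb k t = walk i j t ` {..<N}"
proof
  have "even N"
    using side_walk[OF t, of i j N] N by (cases "side t") simp_all
  have next_in: "walk i j t (Suc l) \<in> walk i j t ` {..<N}" if "l < N" for l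
  proof (cases "Suc l = N")
    case True
    then have "walk i j t (Suc l) = walk i j t 0"
      using N by simp
    then show ?thesis using N by (intro image_eqI[of _ _ 0]) simp_all
  next
    case False
    then show ?thesis using that by (intro imageI) simp
  qed
  have prev_in: "\<sigma> (if even l then j else i) (walk i j t l) \<in> walk i j t ` {..<N}"
    if "l < N" for l
  proof (cases l)
    case 0
    obtain M where M: "N = Suc M"
      using N by (cases N) auto
    then have "walk i j t M = \<sigma> j t"
      using walk_back[OF t, of i j M] N \<open>even N\<close> by (simp split: if_splits)
    then show ?thesis using 0 M by (intro image_eqI[of _ _ M]) simp_all
  next
    case (Suc l')
    then have "walk i j t l' = \<sigma> (if even l then j else i) (walk i j t l)"
      using walk_back[OF t, of i j l'] by (auto simp del: walk.simps)
    then show ?thesis using that Suc by (intro image_eqI[of _ _ l']) simp_all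
  qed
  show "orb k t \<subseteq> walk i j t ` {..<N}"
  proof (rule orb_closed)
    show "t \<in> walk i j t ` {..<N}"
      using N by (intro image_eqI[of _ _ 0]) simp_all
    fix u c assume "u \<in> walk i j t ` {..<N}" "c \<noteq> k"
    then obtain l where l: "l < N" "u = walk i j t l" and c: "c = i \<or> c = j"
      using k(3) by auto
    show "\<sigma> c u \<in> walk i j t ` {..<N}"
      using next_in[OF l(1)] prev_in[OF l(1)] c l(2) by (cases "even l") auto
  qed
  have "walk i j t l \<in> orb k t" for l
  proof (induction l)
    case (Suc l)
    then show ?case
      using orb_step[OF Suc walk_in[OF t]] k(1,2) by simp
  qed simp
  then show "walk i j t ` {..<N} \<subseteq> orb k t"
    by auto
qed

text \<open>On finitely many triangles the walk must meet itself; the first return to the start is then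
reached before any other repetition, which gives the cyclic order of an umbrella.\<close>

lemma walk_closes:
  assumes t: "t \<in> T"
  obtains N where "0 < N" "walk i j t N = t" "inj_on (walk i j t) {..<N}"
proof -
  have "\<not> inj (walk i j t)"
    using finite_T walk_in[OF t] finite_imageD[of "walk i j t" UNIV]
      finite_subset[of "range (walk i j t)" T] by auto
  then obtain l l' where "l < l'" "walk i j t l = walk i j t l'"
    unfolding inj_def by (metis linorder_neqE_nat)
  then obtain l d where "0 < d" "walk i j t l = walk i j t (l + d)"
    using less_imp_add_positive by blast
  then have ex: "\<exists>d. 0 < d \<and> walk i j t d = t"
    using walk_cancel[OF t] by blast
  define N where "N = (LEAST d. 0 < d \<and> walk i j t d = t)"
  have N: "0 < N" "walk i j t N = t"
    using LeastI_ex[OF ex] by (auto simp: N_def)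
  have least: "N \<le> d" if "0 < d" "walk i j t d = t" for d
    unfolding N_def using that by (auto intro: Least_le)
  have "inj_on (walk i j t) {..<N}"
  proof (rule linorder_inj_onI)
    fix l l' assume "l < l'" "l \<in> {..<N}" "l' \<in> {..<N}"
    then show "walk i j t l \<noteq> walk i j t l'"
      using walk_cancel[OF t, of i j l "l' - l"] least[of "l' - l"] by auto
  qed auto
  then show ?thesis
    using that N by blast
qed

end

section \<open>The surface of a coloured gluing\<close>

text \<open>The elements of the surface are given by three labellings of the triangles: \<open>F t\<close> is the face,
\<open>E i t\<close> its edge of colour \<open>i\<close> and \<open>V k t\<close> its corner of colour \<open>k\<close>. The assumptions say exactly
which labels are identified by the gluing. Leaving the labels abstract allows natural
numbers as elements without carrying a coding through the proofs.\<close>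

locale coloured_surface = coloured_gluing T \<sigma> side
  for T :: "'f set" and \<sigma> side +
  fixes F :: "'f \<Rightarrow> 'e" and E V :: "colour \<Rightarrow> 'f \<Rightarrow> 'e"
  assumes F_eq: "t \<in> T \<Longrightarrow> u \<in> T \<Longrightarrow> F t = F u \<longleftrightarrow> t = u"
    and E_eq: "t \<in> T \<Longrightarrow> u \<in> T \<Longrightarrow> E i t = E j u \<longleftrightarrow> i = j \<and> (u = t \<or> u = \<sigma> i t)"
    and V_eq: "t \<in> T \<Longrightarrow> u \<in> T \<Longrightarrow> V k t = V l u \<longleftrightarrow> k = l \<and> u \<in> orb k t"
    and kinds: "t \<in> T \<Longrightarrow> u \<in> T \<Longrightarrow> V k t \<noteq> E i u" "t \<in> T \<Longrightarrow> u \<in> T \<Longrightarrow> V k t \<noteq> F u"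
      "t \<in> T \<Longrightarrow> u \<in> T \<Longrightarrow> E i t \<noteq> F u"

text \<open>A cell is named by the set of triangles around it; finitely many cells can be numbered.\<close>

datatype 'f cell = Face 'f | Edge colour "'f set" | Vertex colour "'f set"

lemma (in coloured_gluing) nat_coloured_surface:
  "\<exists>(F :: 'f \<Rightarrow> nat) E V. coloured_surface T \<sigma> side F E V"
proof -
  let ?C = "Face ` T \<union> (\<lambda>(i, t). Edge i {t, \<sigma> i t}) ` (UNIV \<times> T) \<union>
    (\<lambda>(k, t). Vertex k (orb k t)) ` (UNIV \<times> T)"
  have "finite ?C"
    using finite_T by simp
  then obtain code :: "'f cell \<Rightarrow> nat" where code: "inj_on code ?C"
    using finite_imp_inj_to_nat_seg[of ?C] by blast
  have "coloured_surface T \<sigma> side (\<lambda>t. code (Face t)) (\<lambda>i t. code (Edge i {t, \<sigma> i t}))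
      (\<lambda>k t. code (Vertex k (orb k t)))"
  proof unfold_locales
    fix t u :: 'f and i j k l :: colour
    assume t: "t \<in> T" and u: "u \<in> T"
    have C: "Face v \<in> ?C" "Edge c {v, \<sigma> c v} \<in> ?C" "Vertex c (orb c v) \<in> ?C" if "v \<in> T" for v c
      using image_eqI[of _ "\<lambda>(i, t). Edge i {t, \<sigma> i t}" "(c, v)"]
        image_eqI[of _ "\<lambda>(k, t). Vertex k (orb k t)" "(c, v)"] that by simp_all
    note code_eq = inj_on_eq_iff[OF code]
    show "code (Face t) = code (Face u) \<longleftrightarrow> t = u"
      using code_eq[OF C(1)[OF t] C(1)[OF u]] by simp
    have "{t, \<sigma> i t} = {u, \<sigma> i u} \<longleftrightarrow> u = t \<or> u = \<sigma> i t"
      using glue_glue[OF t, of i] by (auto simp: doubleton_eq_iff)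
    then show "code (Edge i {t, \<sigma> i t}) = code (Edge j {u, \<sigma> j u}) \<longleftrightarrow> i = j \<and> (u = t \<or> u = \<sigma> i t)"
      using code_eq[OF C(2)[OF t, of i] C(2)[OF u, of j]] by auto
    \<comment> \<open>a vertex is named by its orbit, and orbits partition the triangles\<close>
    have "orb k t = orb k u \<longleftrightarrow> u \<in> orb k t"
      by (rule iffI) (simp, simp add: orb_eq)
    then show "code (Vertex k (orb k t)) = code (Vertex l (orb l u)) \<longleftrightarrow> k = l \<and> u \<in> orb k t"
      using code_eq[OF C(3)[OF t, of k] C(3)[OF u, of l]] by auto
    show "code (Vertex k (orb k t)) \<noteq> code (Edge i {u, \<sigma> i u})"
      using code_eq[OF C(3)[OF t, of k] C(2)[OF u, of i]] by simp
    show "code (Vertex k (orb k t)) \<noteq> code (Face u)"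
      using code_eq[OF C(3)[OF t, of k] C(1)[OF u]] by simp
    show "code (Edge i {t, \<sigma> i t}) \<noteq> code (Face u)"
      using code_eq[OF C(2)[OF t, of i] C(1)[OF u]] by simp
  qed
  then show ?thesis
    by blast
qed

context coloured_surface
begin

definition X :: "'e incidence_structure" where
  "X = \<lparr>vertices = {V k t | k t. t \<in> T}, edges = {E i t | i t. t \<in> T}, faces = F ` T,
     incidence = {(V k t, E i t) | k i t. k \<noteq> i \<and> t \<in> T} \<union> {(E i t, F t) | i t. t \<in> T} \<union>
       {(V k t, F t) | k t. t \<in> T}\<rparr>"

lemmas kinds' = kinds kinds[symmetric]

lemma vertices_X: "vertices X = {V k t | k t. t \<in> T}"
  and edges_X: "edges X = {E i t | i t. t \<in> T}"
  and faces_X: "faces X = F ` T"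
  by (simp_all add: X_def)

lemma cells_in [simp]: 
  assumes "t \<in> T" shows "V k t \<in> vertices X" "E i t \<in> edges X" "F t \<in> faces X"
    "V k t \<in> elements X" "E i t \<in> elements X" "F t \<in> elements X"
  using assms by (auto simp: X_def elements_def)

lemma elements_cases:
  assumes "A \<in> elements X"
  obtains (F) t where "t \<in> T" "A = F t" | (E) i t where "t \<in> T" "A = E i t"
    | (V) k t where "t \<in> T" "A = V k t"
  using assms by (auto simp: elements_def X_def)

lemma V_glue: "t \<in> T \<Longrightarrow> k \<noteq> i \<Longrightarrow> V k (\<sigma> i t) = V k t"
  by (simp add: V_eq glue_in orb_sym orb_step)

lemma E_glue: "t \<in> T \<Longrightarrow> E i (\<sigma> i t) = E i t"
  using E_eq[of "\<sigma> i t" t i i] by (simp add: glue_in glue_glue)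

lemma incident_face:
  "t \<in> T \<Longrightarrow> (A, F t) \<in> incidence X \<longleftrightarrow> (\<exists>k. A = V k t) \<or> (\<exists>i. A = E i t)"
  by (auto simp: X_def F_eq kinds')

lemma incidentI:
  assumes "t \<in> T"
  shows "k \<noteq> i \<Longrightarrow> (V k t, E i t) \<in> incidence X" "(E i t, F t) \<in> incidence X"
    "(V k t, F t) \<in> incidence X"
  using assms unfolding X_def by (simp, blast)+

lemma incident_edge:
  assumes "t \<in> T"
  shows "(A, E i t) \<in> incidence X \<longleftrightarrow> (\<exists>k. k \<noteq> i \<and> A = V k t)"
proof
  assume "(A, E i t) \<in> incidence X"
  then obtain k j u where "A = V k u" "k \<noteq> j" "u \<in> T" "E i t = E j u"
    using assms kinds(3)[OF assms] by (auto simp: X_def)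
  then show "\<exists>k. k \<noteq> i \<and> A = V k t"
    using E_eq[OF assms, of u i j] V_glue[OF assms, of k i] by auto
next
  assume "\<exists>k. k \<noteq> i \<and> A = V k t"
  then show "(A, E i t) \<in> incidence X"
    using incidentI(1)[OF assms] by auto
qed

lemma not_incident_vertex: "t \<in> T \<Longrightarrow> (A, V k t) \<notin> incidence X"
  by (auto simp: X_def kinds')

lemma edge_incident:
  assumes "t \<in> T"
  shows "(E i t, B) \<in> incidence X \<longleftrightarrow> B = F t \<or> B = F (\<sigma> i t)"
proof
  assume "(E i t, B) \<in> incidence X"
  then obtain j u where "B = F u" "u \<in> T" "E i t = E j u"
    using assms kinds(1)[OF _ assms] by (auto simp: X_def) metis+
  then show "B = F t \<or> B = F (\<sigma> i t)"
    using E_eq[OF assms, of u i j] by auto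
next
  have "(E i u, F u) \<in> incidence X" if "u \<in> T" for u
    by (rule incidentI(2)[OF that])
  then show "(E i t, B) \<in> incidence X" if "B = F t \<or> B = F (\<sigma> i t)"
    using that assms glue_in[OF assms, of i] E_glue[OF assms, of i] by metis
qed

lemma vertex_incident_face:
  "t \<in> T \<Longrightarrow> u \<in> T \<Longrightarrow> (V k t, F u) \<in> incidence X \<longleftrightarrow> u \<in> orb k t"
  by (auto simp: incident_face V_eq kinds')

lemma vertex_incident_edge:
  "t \<in> T \<Longrightarrow> (V k t, E i t) \<in> incidence X \<longleftrightarrow> k \<noteq> i"
  by (auto simp: incident_edge V_eq)

lemma faces_at_V: "t \<in> T \<Longrightarrow> faces_at X (V k t) = F ` orb k t"
  using orb_subset[of t k] by (auto simp: faces_at_def faces_X vertex_incident_face)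

lemma inj_on_F: "inj_on F T"
  by (simp add: inj_on_def F_eq)

lemma card_faces_at: "t \<in> T \<Longrightarrow> card (faces_at X (V k t)) = card (orb k t)"
  using faces_at_V orb_subset inj_on_F by (metis card_image inj_on_subset)

lemma boundary_F: "t \<in> T \<Longrightarrow> boundary X (F t) = range (\<lambda>k. V k t) \<union> range (\<lambda>i. E i t)"
  unfolding boundary_def by (auto simp: incident_face)

lemma inj_V: "t \<in> T \<Longrightarrow> inj (\<lambda>k. V k t)"
  by (simp add: inj_def V_eq)

lemma inj_E: "t \<in> T \<Longrightarrow> inj (\<lambda>i. E i t)"
  by (simp add: inj_def E_eq)

text \<open>The umbrella is the closed walk around the corner; consecutive triangles share the edge that
the walk crosses.\<close>

lemma umbrella_exists:
  assumes t: "t \<in> T"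
  shows "\<exists>Fs. umbrella X (V k t) Fs"
proof -
  obtain i j where ij: "i \<noteq> k" "j \<noteq> k" "\<forall>c. c \<noteq> k \<longrightarrow> c = i \<or> c = j"
    by (rule other_colours[of k])
  obtain N where N: "0 < N" "walk i j t N = t" "inj_on (walk i j t) {..<N}"
    using walk_closes[OF t, of i j] .
  have orb: "orb k t = walk i j t ` {..<N}"
    using orb_eq_walk[OF t ij N(1,2)] .
  let ?Fs = "map (\<lambda>l. F (walk i j t l)) [0..<N]"
  have inj: "inj_on (\<lambda>l. F (walk i j t l)) {0..<N}"
    using N(3) walk_in[OF t] by (auto simp: inj_on_def F_eq)
  have "\<exists>e\<in>edges X. (V k t, e) \<in> incidence X \<and> (e, ?Fs ! l) \<in> incidence X \<and>
      (e, ?Fs ! (Suc l mod length ?Fs)) \<in> incidence X" if "l < N" for l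
  proof -
    \<comment> \<open>colour of the edge between the triangles at positions l and l + 1\<close>
    define c where "c = (if even l then i else j)"
    let ?u = "walk i j t l"
    have u: "?u \<in> T" "?u \<in> orb k t"
      using walk_in[OF t] orb that by auto
    have "walk i j t (Suc l mod N) = \<sigma> c ?u"
    proof (cases "Suc l = N")
      case True
      then show ?thesis using N(2) by (auto simp: c_def)
    qed (use that in \<open>simp add: c_def\<close>)
    moreover have "V k t = V k ?u"
      using u t by (simp add: V_eq)
    moreover have "k \<noteq> c"
      using ij by (auto simp: c_def)
    ultimately have "(V k t, E c ?u) \<in> incidence X" "(E c ?u, ?Fs ! l) \<in> incidence X"
      "(E c ?u, ?Fs ! (Suc l mod length ?Fs)) \<in> incidence X"
      using u that N(1) incidentI[OF u(1)] edge_incident[OF u(1)]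
      by (simp_all del: walk.simps)
    then show ?thesis
      using u(1) cells_in(2) by blast
  qed
  then have "umbrella X (V k t) ?Fs"
    unfolding umbrella_def using inj by (auto simp: distinct_map faces_at_V[OF t] orb)
  then show ?thesis ..
qed

lemma surface: "simplicial_surface X"
proof
  have "vertices X = (\<lambda>(k, t). V k t) ` (UNIV \<times> T)" "edges X = (\<lambda>(k, t). E k t) ` (UNIV \<times> T)"
    by (auto simp: X_def)
  then show "countable (elements X)"
    unfolding elements_def faces_X using finite_T by (simp add: countable_finite)
  show "vertices X \<noteq> {}" "edges X \<noteq> {}" "faces X \<noteq> {}"
    using T_nonempty by (auto simp: X_def)
  show "vertices X \<inter> edges X = {}" "vertices X \<inter> faces X = {}" "edges X \<inter> faces X = {}"
    by (auto simp: X_def kinds')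
  show "incidence X \<subseteq> vertices X \<times> edges X \<union> edges X \<times> faces X \<union> vertices X \<times> faces X"
    by (auto simp: X_def)
next
  fix e assume "e \<in> edges X"
  then obtain i t where e: "e = E i t" and t: "t \<in> T"
    by (auto simp: edges_X)
  have "{A \<in> vertices X. (A, e) \<in> incidence X} = (\<lambda>k. V k t) ` {k. k \<noteq> i}"
    using t by (auto simp: e incident_edge)
  then show "card {A \<in> vertices X. (A, e) \<in> incidence X} = 2"
    using card_image[OF inj_on_subset[OF inj_V[OF t]]] card_other_colours by simp
  have "{A \<in> faces X. (e, A) \<in> incidence X} = {F t, F (\<sigma> i t)}"
    using t glue_in by (auto simp: e edge_incident)
  then show "card {A \<in> faces X. (e, A) \<in> incidence X} = 2"
    using t glue_in[OF t] glue_fixfree[OF t, of i] by (auto simp: F_eq card_2_iff)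
next
  fix f assume "f \<in> faces X"
  then obtain t where f: "f = F t" and t: "t \<in> T"
    by (auto simp: faces_X)
  have "{A \<in> edges X. (A, f) \<in> incidence X} = range (\<lambda>i. E i t)"
    using t by (auto simp: f incident_face edges_X kinds')
  then show "card {A \<in> edges X. (A, f) \<in> incidence X} = 3"
    using card_image[OF inj_E[OF t]] card_UNIV_colour by simp
  have "{A \<in> vertices X. (A, f) \<in> incidence X} = range (\<lambda>i. V i t)"
    using t by (auto simp: f incident_face vertices_X kinds')
  then show "card {A \<in> vertices X. (A, f) \<in> incidence X} = 3"
    using card_image[OF inj_V[OF t]] card_UNIV_colour by simp
  fix v assume "v \<in> vertices X" "(v, f) \<in> incidence X"
  then obtain k where v: "v = V k t"
    using t by (auto simp: f incident_face vertices_X kinds')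
  have "{A \<in> edges X. (A, f) \<in> incidence X \<and> (v, A) \<in> incidence X} = (\<lambda>i. E i t) ` {i. i \<noteq> k}"
    using t by (auto simp: f v incident_face vertex_incident_edge not_incident_vertex)
  then show "card {A \<in> edges X. (A, f) \<in> incidence X \<and> (v, A) \<in> incidence X} = 2"
    using card_image[OF inj_on_subset[OF inj_E[OF t]]] card_other_colours by simp
next
  fix v assume "v \<in> vertices X"
  then obtain k t where v: "v = V k t" and t: "t \<in> T"
    by (auto simp: vertices_X)
  show "finite (faces_at X v) \<and> 3 \<le> card (faces_at X v)"
    using t card_orb_ge_3[OF t, of k] card_faces_at[OF t, of k]
    by (simp add: v faces_at_V finite_orb)
  show "\<exists>Fs. umbrella X v Fs"
    unfolding v using umbrella_exists[OF t] .
qed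

section \<open>Rigidity of connected coloured surfaces\<close>

text \<open>The part of being an automorphism that the rigidity and degree arguments use. Automorphisms
and their inverses have it, and it is visibly closed under composition.\<close>

definition embedding :: "('e \<Rightarrow> 'e) \<Rightarrow> bool" where
  "embedding \<phi> \<longleftrightarrow> \<phi> \<in> elements X \<rightarrow> elements X \<and> inj_on \<phi> (elements X) \<and>
     (\<forall>A B. (A, B) \<in> incidence X \<longrightarrow> (\<phi> A, \<phi> B) \<in> incidence X)"

lemma incidence_cases:
  assumes "(A, B) \<in> incidence X"
  obtains (VE) k i t where "t \<in> T" "k \<noteq> i" "A = V k t" "B = E i t"
    | (EF) i t where "t \<in> T" "A = E i t" "B = F t"
    | (VF) k t where "t \<in> T" "A = V k t" "B = F t"
  using assms unfolding X_def by (simp, blast)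

text \<open>Only the chain vertex, edge, face has length three. Hence maps that preserve incidence
cannot mix up the three kinds of elements.\<close>

lemma incident_chain:
  assumes "(A, B) \<in> incidence X" "(B, C) \<in> incidence X"
  shows "A \<in> vertices X" "B \<in> edges X" "C \<in> faces X"
proof -
  have "(F t, C) \<notin> incidence X" if "t \<in> T" for t
  proof
    assume "(F t, C) \<in> incidence X"
    then show False
      by (cases rule: incidence_cases) (use that kinds in metis)+
  qed
  with assms show "A \<in> vertices X" "B \<in> edges X" "C \<in> faces X"
    by (cases rule: incidence_cases; auto simp: edge_incident glue_in)+
qed

lemma embedding_kinds:
  assumes "embedding \<phi>" and t: "t \<in> T"
  shows "\<phi> (V k t) \<in> vertices X" "\<phi> (E i t) \<in> edges X" "\<phi> (F t) \<in> faces X"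
proof -
  have chain: "(\<phi> (V l t), \<phi> (E j t)) \<in> incidence X" "(\<phi> (E j t), \<phi> (F t)) \<in> incidence X"
    if "l \<noteq> j" for l j
    using assms that incidentI[OF t] by (auto simp: embedding_def)
  obtain l j where "k \<noteq> l" "j \<noteq> i"
    using other_colours[of k] other_colours[of i] by metis
  then show "\<phi> (V k t) \<in> vertices X" "\<phi> (E i t) \<in> edges X" "\<phi> (F t) \<in> faces X"
    using incident_chain[OF chain(1,2)] by blast+
qed

lemma embedding_comp:
  assumes "embedding \<phi>" "embedding \<psi>"
  shows "embedding (\<lambda>A. \<phi> (\<psi> A))"
proof -
  have "inj_on (\<phi> \<circ> \<psi>) (elements X)"
    using assms unfolding embedding_def by (intro comp_inj_on) (auto intro: inj_on_subset)
  then show ?thesis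
    using assms unfolding embedding_def comp_def by blast
qed

text \<open>In a face the edge of colour \<open>i\<close> is the one that meets both corners of colour different from \<open>i\<close>.\<close>

lemma edge_fixed:
  assumes \<phi>: "embedding \<phi>" and t: "t \<in> T"
    and fixF: "\<phi> (F t) = F t" and fixV: "\<And>k. \<phi> (V k t) = V k t"
  shows "\<phi> (E i t) = E i t"
proof -
  have "(\<phi> (E i t), F t) \<in> incidence X"
    using \<phi> fixF incidentI(2)[OF t, of i] unfolding embedding_def by metis
  then obtain j where j: "\<phi> (E i t) = E j t"
    using embedding_kinds(2)[OF \<phi> t, of i] kinds(1)[OF t]
    by (auto simp: incident_face[OF t] edges_X)
  have "(V k t, E j t) \<in> incidence X" if "k \<noteq> i" for k
    using \<phi> fixV j incidentI(1)[OF t that] unfolding embedding_def by metis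
  then have "j = i"
    using vertex_incident_edge[OF t] by blast
  then show ?thesis
    using j by simp
qed

text \<open>The fixed triangles propagate. If \<open>t\<close> is fixed with its corners, then so are its edges, and
the image of the triangle across an edge can only be one of the two triangles at that edge;
injectivity excludes \<open>t\<close> itself. The neighbour shares two corners with \<open>t\<close>, so its third
corner has only one place left to go.\<close>

lemma rigidity:
  assumes \<phi>: "embedding \<phi>" and s: "s \<in> T"
    and fixF: "\<phi> (F s) = F s" and fixV: "\<And>k. \<phi> (V k s) = V k s"
    and connected: "\<And>t. t \<in> T \<Longrightarrow> (s, t) \<in> connection"
    and A: "A \<in> elements X"
  shows "\<phi> A = A"
proof -
  have fixed: "t \<in> T \<and> \<phi> (F t) = F t \<and> (\<forall>k. \<phi> (V k t) = V k t)" if "(s, t) \<in> connection" for t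
    using that unfolding connection_def
  proof induction
    case (step t u)
    then obtain i where u: "u = \<sigma> i t" and t: "t \<in> T"
      by auto
    have uT: "u \<in> T"
      using glue_in[OF t] u by simp
    have "(\<phi> (E i t), \<phi> (F u)) \<in> incidence X"
      using \<phi> edge_incident[OF t, of i "F u"] u unfolding embedding_def by metis
    then have "\<phi> (F u) = F t \<or> \<phi> (F u) = F u"
      using edge_fixed[OF \<phi> t] step.IH edge_incident[OF t, of i] u by simp
    moreover have "\<phi> (F u) \<noteq> \<phi> (F t)"
    proof
      assume "\<phi> (F u) = \<phi> (F t)"
      then have "F u = F t"
        using \<phi> t uT unfolding embedding_def by (meson cells_in(6) inj_onD)
      then show False
        using F_eq[OF uT t] glue_fixfree[OF t, of i] u by simp
    qed
    ultimately have F: "\<phi> (F u) = F u"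
      using step.IH by simp
    have V: "\<phi> (V k u) = V k u" if "k \<noteq> i" for k
      using V_glue[OF t that] step.IH u by simp
    have "(\<phi> (V i u), F u) \<in> incidence X"
      using \<phi> F incidentI(3)[OF uT, of i] unfolding embedding_def by metis
    then obtain l where l: "\<phi> (V i u) = V l u"
      using embedding_kinds(1)[OF \<phi> uT, of i] kinds(1)[OF _ uT, symmetric]
      by (auto simp: incident_face[OF uT] vertices_X)
    have "l = i"
    proof (rule ccontr)
      assume "l \<noteq> i"
      then have "\<phi> (V l u) = \<phi> (V i u)"
        using V l by simp
      then have "V l u = V i u"
        using \<phi> uT unfolding embedding_def by (meson cells_in(4) inj_onD)
      then show False
        using \<open>l \<noteq> i\<close> V_eq[OF uT uT] by simp
    qed
    then have "\<phi> (V k u) = V k u" for k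
      using V l by (cases "k = i") auto
    then show ?case
      using uT F by simp
  qed (use s fixF fixV in auto)
  from A show ?thesis
  proof (cases rule: elements_cases)
    case (E i t)
    then show ?thesis
      \<comment> \<open>every edge is an edge of some triangle, and all triangles are fixed\<close>
      using edge_fixed[OF \<phi>] fixed[OF connected] by simp
  qed (use fixed[OF connected] in auto)
qed

lemma card_faces_at_le:
  assumes \<phi>: "embedding \<phi>" and v: "v \<in> vertices X"
  shows "card (faces_at X v) \<le> card (faces_at X (\<phi> v))"
proof (rule card_inj_on_le)
  show "inj_on \<phi> (faces_at X v)"
    using \<phi> unfolding embedding_def faces_at_def elements_def by (auto intro: inj_on_subset)
  show "\<phi> ` faces_at X v \<subseteq> faces_at X (\<phi> v)"
    using \<phi> embedding_kinds(3)[OF \<phi>] by (auto simp: faces_at_def faces_X embedding_def)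
  show "finite (faces_at X (\<phi> v))"
    using finite_T by (simp add: faces_at_def faces_X)
qed

lemma automorphism_embedding:
  assumes "\<phi> \<in> automorphisms X"
  obtains \<psi> where "embedding \<phi>" "embedding \<psi>"
    "\<forall>A\<in>elements X. \<psi> (\<phi> A) = A" "\<forall>A\<in>elements X. \<phi> (\<psi> A) = A"
proof -
  obtain \<psi> where hom: "\<phi> \<in> surface_hom X X" "\<psi> \<in> surface_hom X X"
    and inv: "\<forall>A\<in>elements X. \<psi> (\<phi> A) = A" "\<forall>A\<in>elements X. \<phi> (\<psi> A) = A"
    using assms unfolding automorphisms_def by auto
  have "inj_on \<phi> (elements X)" "inj_on \<psi> (elements X)"
    using inv by (metis inj_on_inverseI)+
  then have "embedding \<phi>" "embedding \<psi>"
    using hom unfolding embedding_def surface_hom_def by auto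
  then show ?thesis
    using that inv by blast
qed

text \<open>The faces at a vertex are mapped injectively to the faces at its image, and the same holds
for the inverse map.\<close>

lemma automorphism_degree:
  assumes "\<phi> \<in> automorphisms X" and t: "t \<in> T"
  shows "card (faces_at X (\<phi> (V k t))) = card (orb k t)"
proof -
  obtain \<psi> where \<phi>: "embedding \<phi>" and \<psi>: "embedding \<psi>"
    and inv: "\<forall>A\<in>elements X. \<psi> (\<phi> A) = A" "\<forall>A\<in>elements X. \<phi> (\<psi> A) = A"
    by (rule automorphism_embedding[OF assms(1)])
  show ?thesis
    using card_faces_at_le[OF \<phi> cells_in(1)[OF t], of k]
      card_faces_at_le[OF \<psi> embedding_kinds(1)[OF \<phi> t], of k] inv cells_in(4)[OF t, of k]
      card_faces_at[OF t, of k] by simp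
qed

lemma automorphism_Bij: "automorphisms X \<subseteq> Bij (elements X)"
proof
  fix \<phi> assume \<phi>: "\<phi> \<in> automorphisms X"
  obtain \<psi> where "embedding \<phi>" "embedding \<psi>"
    "\<forall>A\<in>elements X. \<psi> (\<phi> A) = A" "\<forall>A\<in>elements X. \<phi> (\<psi> A) = A"
    by (rule automorphism_embedding[OF \<phi>])
  then have "bij_betw \<phi> (elements X) (elements X)"
    unfolding embedding_def by (intro bij_betw_byWitness[of _ \<psi>]) auto
  then show "\<phi> \<in> Bij (elements X)"
    using \<phi> by (simp add: Bij_def automorphisms_def)
qed

section \<open>Automorphisms induced by symmetries of the gluing\<close>

definition symmetry :: "('f \<Rightarrow> 'f) \<Rightarrow> bool" where
  "symmetry \<tau> \<longleftrightarrow> (\<forall>t\<in>T. \<tau> t \<in> T \<and> (\<forall>i. \<tau> (\<sigma> i t) = \<sigma> i (\<tau> t)))"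

text \<open>A permutation of the triangles that commutes with the gluing acts on faces, edges and
vertices. The description does not depend on the triangle that names an edge or vertex, so
the definite description below is proper.\<close>

definition induced :: "('f \<Rightarrow> 'f) \<Rightarrow> 'e \<Rightarrow> 'e" where
  "induced \<tau> = (\<lambda>A\<in>elements X. THE B. \<exists>t\<in>T. (A = F t \<and> B = F (\<tau> t)) \<or>
     (\<exists>i. A = E i t \<and> B = E i (\<tau> t)) \<or> (\<exists>k. A = V k t \<and> B = V k (\<tau> t)))"

lemma orb_symmetry:
  assumes \<tau>: "symmetry \<tau>" and t: "t \<in> T" and u: "u \<in> orb k t"
  shows "\<tau> u \<in> orb k (\<tau> t)"
proof -
  have "orb k t \<subseteq> {u \<in> T. \<tau> u \<in> orb k (\<tau> t)}"
    using \<tau> t unfolding symmetry_def by (intro orb_closed) (auto intro: orb_step glue_in)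
  then show ?thesis
    using u by auto
qed

lemma induced_F:
  assumes "symmetry \<tau>" and t: "t \<in> T"
  shows "induced \<tau> (F t) = F (\<tau> t)"
proof -
  have "(THE B. \<exists>u\<in>T. (F t = F u \<and> B = F (\<tau> u)) \<or>
      (\<exists>i. F t = E i u \<and> B = E i (\<tau> u)) \<or> (\<exists>k. F t = V k u \<and> B = V k (\<tau> u))) = F (\<tau> t)"
    (is "The ?P = _")
  proof (rule the_equality)
    show "?P (F (\<tau> t))"
      using t by blast
    show "B = F (\<tau> t)" if "?P B" for B
      using that F_eq[OF t] kinds(2)[OF _ t, symmetric] kinds(3)[OF _ t, symmetric] by auto
  qed
  then show ?thesis
    using t by (simp add: induced_def)
qed

lemma induced_E:
  assumes \<tau>: "symmetry \<tau>" and t: "t \<in> T"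
  shows "induced \<tau> (E i t) = E i (\<tau> t)"
proof -
  have "(THE B. \<exists>u\<in>T. (E i t = F u \<and> B = F (\<tau> u)) \<or>
      (\<exists>j. E i t = E j u \<and> B = E j (\<tau> u)) \<or> (\<exists>k. E i t = V k u \<and> B = V k (\<tau> u))) = E i (\<tau> t)"
    (is "The ?P = _")
  proof (rule the_equality)
    show "?P (E i (\<tau> t))"
      using t by blast
    fix B assume "?P B"
    then obtain j u where u: "u \<in> T" "E i t = E j u" and B: "B = E j (\<tau> u)"
      using kinds(1)[OF _ t, symmetric] kinds(3)[OF t] by auto
    then have "j = i" "u = t \<or> u = \<sigma> i t"
      using E_eq[OF t u(1)] by auto
    moreover have "E i (\<tau> (\<sigma> i t)) = E i (\<tau> t)"
      using \<tau> t E_glue unfolding symmetry_def by metis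
    ultimately show "B = E i (\<tau> t)"
      using B by auto
  qed
  then show ?thesis
    using t by (simp add: induced_def)
qed

lemma induced_V:
  assumes \<tau>: "symmetry \<tau>" and t: "t \<in> T"
  shows "induced \<tau> (V k t) = V k (\<tau> t)"
proof -
  have "(THE B. \<exists>u\<in>T. (V k t = F u \<and> B = F (\<tau> u)) \<or>
      (\<exists>i. V k t = E i u \<and> B = E i (\<tau> u)) \<or> (\<exists>l. V k t = V l u \<and> B = V l (\<tau> u))) = V k (\<tau> t)"
    (is "The ?P = _")
  proof (rule the_equality)
    show "?P (V k (\<tau> t))"
      using t by blast
    fix B assume "?P B"
    then obtain l u where u: "u \<in> T" "V k t = V l u" and B: "B = V l (\<tau> u)"
      using kinds(1)[OF t] kinds(2)[OF t] by auto
    then have "l = k" "u \<in> orb k t"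
      using V_eq[OF t u(1)] by auto
    then have "V k (\<tau> t) = V k (\<tau> u)"
      using V_eq[of "\<tau> t" "\<tau> u" k k] orb_symmetry[OF \<tau> t] \<tau> t u(1) unfolding symmetry_def
      by auto
    then show "B = V k (\<tau> t)"
      using B \<open>l = k\<close> by simp
  qed
  then show ?thesis
    using t by (simp add: induced_def)
qed

lemmas induced_cells = induced_F induced_E induced_V

lemma induced_hom:
  assumes \<tau>: "symmetry \<tau>"
  shows "induced \<tau> \<in> surface_hom X X"
proof -
  note ind = induced_cells[OF \<tau>]
  have \<tau>T: "\<tau> t \<in> T" if "t \<in> T" for t
    using \<tau> that by (simp add: symmetry_def)
  have "induced \<tau> A \<in> elements X" if "A \<in> elements X" for A
    using that by (cases rule: elements_cases) (auto simp: ind \<tau>T)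
  moreover have "(induced \<tau> A, induced \<tau> B) \<in> incidence X" if "(A, B) \<in> incidence X" for A B
    using that by (cases rule: incidence_cases) (auto simp: ind incidentI \<tau>T)
  moreover have "bij_betw (induced \<tau>) (boundary X f) (boundary X (induced \<tau> f)) \<and>
      (\<forall>A\<in>boundary X f. \<forall>B\<in>boundary X f.
        (A, B) \<in> incidence X \<longleftrightarrow> (induced \<tau> A, induced \<tau> B) \<in> incidence X)"
    if fX: "f \<in> faces X" for f
  proof -
    obtain t where f: "f = F t" and t: "t \<in> T"
      using fX by (auto simp: faces_X)
    have bd: "boundary X f = range (\<lambda>k. V k t) \<union> range (\<lambda>i. E i t)"
      by (simp add: f boundary_F[OF t])
    have bd': "boundary X (induced \<tau> f) = range (\<lambda>k. V k (\<tau> t)) \<union> range (\<lambda>i. E i (\<tau> t))"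
      by (simp add: f ind t \<tau>T boundary_F)
    have inj: "inj_on (induced \<tau>) (boundary X f)"
      unfolding bd inj_on_def
      using V_eq[OF \<tau>T \<tau>T, OF t t] E_eq[OF \<tau>T \<tau>T, OF t t] kinds(1)[OF \<tau>T \<tau>T, OF t t]
      by (auto simp: ind t) metis+
    have im: "induced \<tau> ` boundary X f = boundary X (induced \<tau> f)"
      unfolding bd bd' by (simp add: image_Un image_image ind t)
    have "(A, B) \<in> incidence X \<longleftrightarrow> (induced \<tau> A, induced \<tau> B) \<in> incidence X"
      if "A \<in> boundary X f" "B \<in> boundary X f" for A B
      using that unfolding bd
      by (auto simp: ind t \<tau>T not_incident_vertex incident_edge V_eq kinds')
    then show ?thesis
      using inj im by (auto simp: bij_betw_def)
  qed
  ultimately show ?thesis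
    unfolding surface_hom_def by blast
qed

lemma induced_comp:
  assumes "symmetry \<tau>" "symmetry \<upsilon>" "A \<in> elements X"
  shows "induced \<tau> (induced \<upsilon> A) = induced (\<lambda>t. \<tau> (\<upsilon> t)) A"
proof -
  have comp: "symmetry (\<lambda>t. \<tau> (\<upsilon> t))"
    using assms(1,2) by (simp add: symmetry_def)
  have \<upsilon>T: "\<upsilon> t \<in> T" if "t \<in> T" for t
    using assms(2) that by (simp add: symmetry_def)
  from assms(3) show ?thesis
    by (cases rule: elements_cases) (auto simp: induced_cells assms(1,2) comp \<upsilon>T)
qed

lemma induced_cong:
  assumes "symmetry \<tau>" "\<And>t. t \<in> T \<Longrightarrow> \<upsilon> t = \<tau> t"
  shows "induced \<tau> = induced \<upsilon>"
proof
  fix A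
  have \<upsilon>: "symmetry \<upsilon>"
    using assms glue_in unfolding symmetry_def by metis
  show "induced \<tau> A = induced \<upsilon> A"
  proof (cases "A \<in> elements X")
    case True
    then show ?thesis
      by (cases rule: elements_cases) (auto simp: induced_cells assms(1) \<upsilon> assms(2))
  qed (simp add: induced_def)
qed

lemma induced_identity:
  assumes "\<And>t. t \<in> T \<Longrightarrow> \<tau> t = t" "A \<in> elements X"
  shows "induced \<tau> A = A"
proof -
  have \<tau>: "symmetry \<tau>"
    using assms(1) glue_in by (auto simp: symmetry_def)
  from assms(2) show ?thesis
    by (cases rule: elements_cases) (auto simp: induced_cells assms(1) \<tau>)
qed

lemma induced_inverse:
  assumes "symmetry \<tau>" "symmetry \<upsilon>" "\<And>t. t \<in> T \<Longrightarrow> \<tau> (\<upsilon> t) = t" "A \<in> elements X"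
  shows "induced \<tau> (induced \<upsilon> A) = A"
  using induced_comp[OF assms(1,2,4)] induced_identity[OF assms(3,4)] by simp

lemma induced_automorphism:
  assumes "symmetry \<tau>" "symmetry \<upsilon>"
    and "\<And>t. t \<in> T \<Longrightarrow> \<tau> (\<upsilon> t) = t" "\<And>t. t \<in> T \<Longrightarrow> \<upsilon> (\<tau> t) = t"
  shows "induced \<tau> \<in> automorphisms X"
proof -
  have "induced \<tau> \<in> extensional (elements X)"
    by (simp add: induced_def)
  moreover have "\<forall>A\<in>elements X. induced \<upsilon> (induced \<tau> A) = A \<and> induced \<tau> (induced \<upsilon> A) = A"
    using induced_inverse assms by blast
  ultimately show ?thesis
    unfolding automorphisms_def using induced_hom assms(1,2) by blast
qed

text \<open>The group \<open>H\<close> acts on the surface, and the action is free on the face of \<open>s\<close>. Conversely an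
automorphism preserves degrees, so it takes \<open>s\<close> to a triangle whose corners have the same
set of degrees, which by assumption is a translate \<open>\<tau> g s\<close>. As the three degrees are
distinct, the automorphism agrees with the action of \<open>g\<close> on the corners of \<open>s\<close>, hence
everywhere by rigidity.\<close>

theorem Aut_iso:
  fixes H :: "('g, 'h) monoid_scheme"
  assumes H: "group H" and s: "s \<in> T"
    and sym: "\<And>g. g \<in> carrier H \<Longrightarrow> symmetry (\<tau> g)"
    and mult: "\<And>g h t. g \<in> carrier H \<Longrightarrow> h \<in> carrier H \<Longrightarrow> t \<in> T \<Longrightarrow>
      \<tau> (g \<otimes>\<^bsub>H\<^esub> h) t = \<tau> g (\<tau> h t)"
    and one: "\<And>t. t \<in> T \<Longrightarrow> \<tau> \<one>\<^bsub>H\<^esub> t = t"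
    and free: "\<And>g h. g \<in> carrier H \<Longrightarrow> h \<in> carrier H \<Longrightarrow> \<tau> g s = \<tau> h s \<Longrightarrow> g = h"
    and connected: "\<And>t. t \<in> T \<Longrightarrow> (s, t) \<in> connection"
    and degrees_distinct: "inj (\<lambda>k. card (orb k s))"
    and degrees_recognise: "\<And>t. t \<in> T \<Longrightarrow>
      range (\<lambda>k. card (orb k t)) = range (\<lambda>k. card (orb k s)) \<Longrightarrow> \<exists>g\<in>carrier H. t = \<tau> g s"
  shows "Aut X \<cong> H"
proof -
  interpret H: group H
    by (rule H)
  have inv: "\<tau> g (\<tau> (inv\<^bsub>H\<^esub> g) t) = t" "\<tau> (inv\<^bsub>H\<^esub> g) (\<tau> g t) = t" if "g \<in> carrier H" "t \<in> T" for g t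
    using that mult[of g "inv\<^bsub>H\<^esub> g" t] mult[of "inv\<^bsub>H\<^esub> g" g t] one[of t] by simp_all
  \<comment> \<open>the isomorphism from \<open>H\<close> to the automorphism group\<close>
  define f where "f g = induced (\<tau> g)" for g
  have f_aut: "f g \<in> automorphisms X" if "g \<in> carrier H" for g
    unfolding f_def using that by (intro induced_automorphism[of _ "\<tau> (inv\<^bsub>H\<^esub> g)"] sym inv) auto
  have f_hom: "f \<in> hom H (Aut X)"
  proof (rule homI)
    fix g h assume gh: "g \<in> carrier H" "h \<in> carrier H"
    have "f (g \<otimes>\<^bsub>H\<^esub> h) = induced (\<lambda>t. \<tau> g (\<tau> h t))"
      unfolding f_def using gh by (intro induced_cong sym) (auto simp: mult)
    also have "\<dots> = compose (elements X) (f g) (f h)"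
    proof
      fix A
      show "induced (\<lambda>t. \<tau> g (\<tau> h t)) A = compose (elements X) (f g) (f h) A"
        using induced_comp[OF sym[OF gh(1)] sym[OF gh(2)], of A]
        by (cases "A \<in> elements X") (auto simp: compose_def f_def induced_def)
    qed
    also have "\<dots> = f g \<otimes>\<^bsub>Aut X\<^esub> f h"
      using f_aut gh automorphism_Bij by (auto simp: Aut_def BijGroup_def)
    finally show "f (g \<otimes>\<^bsub>H\<^esub> h) = f g \<otimes>\<^bsub>Aut X\<^esub> f h" .
  qed (simp add: Aut_def f_aut)
  have f_inj: "inj_on f (carrier H)"
  proof (rule inj_onI)
    fix g h assume gh: "g \<in> carrier H" "h \<in> carrier H" "f g = f h"
    then have "F (\<tau> g s) = F (\<tau> h s)"
      using induced_F[OF sym s, of g] induced_F[OF sym s, of h] by (simp add: f_def)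
    then show "g = h"
      using gh free[of g h] sym s F_eq[of "\<tau> g s" "\<tau> h s"] by (simp add: symmetry_def)
  qed
  have f_surj: "\<phi> \<in> f ` carrier H" if \<phi>: "\<phi> \<in> automorphisms X" for \<phi>
  proof -
    obtain \<psi> where emb: "embedding \<phi>"
      using automorphism_embedding[OF \<phi>] by blast
    obtain t where t: "t \<in> T" "\<phi> (F s) = F t"
      using embedding_kinds(3)[OF emb s] by (auto simp: faces_X)
    have "\<exists>l. \<phi> (V k s) = V l t" for k
    proof -
      have "(\<phi> (V k s), F t) \<in> incidence X"
        using emb incidentI(3)[OF s, of k] t(2) unfolding embedding_def by metis
      then show ?thesis
        using embedding_kinds(1)[OF emb s, of k] kinds(1)[OF _ t(1), symmetric]
        by (auto simp: incident_face[OF t(1)] vertices_X)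
    qed
    then obtain \<pi> where \<pi>: "\<And>k. \<phi> (V k s) = V (\<pi> k) t"
      by metis
    have deg: "card (orb (\<pi> k) t) = card (orb k s)" for k
      using automorphism_degree[OF \<phi> s, of k] \<pi>[of k] card_faces_at[OF t(1)] by simp
    have "inj \<pi>"
      using deg degrees_distinct unfolding inj_def by metis
    \<comment> \<open>the corners of \<open>s\<close> are permuted onto those of \<open>t\<close>, so both triangles have the same set of degrees\<close>
    then have "surj \<pi>"
      by (simp add: finite_UNIV_inj_surj)
    have "range (\<lambda>k. card (orb k t)) = range (\<lambda>k. card (orb (\<pi> k) t))"
      using arg_cong[OF \<open>surj \<pi>\<close>, of "\<lambda>K. (\<lambda>k. card (orb k t)) ` K"] by (simp add: image_image)
    then have "range (\<lambda>k. card (orb k t)) = range (\<lambda>k. card (orb k s))"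
      by (simp add: deg)
    then obtain g where g: "g \<in> carrier H" "t = \<tau> g s"
      using degrees_recognise t(1) by blast
    \<comment> \<open>the two degree sequences agree as sequences, because \<open>t\<close> is a translate of \<open>s\<close>\<close>
    have "card (orb k t) = card (orb k s)" for k
      using automorphism_degree[OF f_aut[OF g(1)] s, of k] induced_V[OF sym[OF g(1)] s, of k]
        card_faces_at[OF t(1)] g(2) by (simp add: f_def)
    then have "\<pi> k = k" for k
      using deg[of k] degrees_distinct by (metis injD)
    then have V: "\<phi> (V k s) = V k t" for k
      using \<pi> by simp
    have g': "inv\<^bsub>H\<^esub> g \<in> carrier H"
      using g(1) by simp
    have emb': "embedding (f (inv\<^bsub>H\<^esub> g))"
      using automorphism_embedding[OF f_aut[OF g']] by blast
    \<comment> \<open>undoing \<open>\<phi>\<close> on \<open>s\<close> by a group element leaves an automorphism that fixes \<open>s\<close> with its corners\<close>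
    have "f (inv\<^bsub>H\<^esub> g) (\<phi> A) = A" if "A \<in> elements X" for A
    proof (rule rigidity[OF embedding_comp[OF emb' emb] s _ _ connected that])
      show "f (inv\<^bsub>H\<^esub> g) (\<phi> (F s)) = F s" "f (inv\<^bsub>H\<^esub> g) (\<phi> (V k s)) = V k s" for k
        using induced_cells[OF sym[OF g'] t(1)] t V g(2) inv(2)[OF g(1) s] by (simp_all add: f_def)
    qed
    then have "f g A = \<phi> A" if "A \<in> elements X" for A
      using that induced_inverse[OF sym[OF g(1)] sym[OF g'] inv(1)[OF g(1)], of "\<phi> A"] emb
      unfolding f_def embedding_def by (metis PiE)
    moreover have "\<phi> \<in> extensional (elements X)" "f g \<in> extensional (elements X)"
      using \<phi> f_aut[OF g(1)] by (auto simp: automorphisms_def)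
    ultimately have "f g = \<phi>"
      by (intro extensionalityI) auto
    then show ?thesis
      using g(1) by blast
  qed
  have "f ` carrier H = carrier (Aut X)"
    using f_surj f_aut by (auto simp: Aut_def)
  then have "f \<in> iso H (Aut X)"
    using f_hom f_inj by (simp add: iso_def bij_betw_def)
  then show ?thesis
    using H.iso_sym is_isoI by blast
qed

end

section \<open>A gluing with voltages in a group\<close>

text \<open>The pattern of the blue gluings inside one sheet, for the positions \<open>0\<close> to \<open>10\<close>. The 3-cycle
\<open>0, 8, 5\<close> makes a green corner of degree \<open>6\<close> at position \<open>0\<close>, and the transposition \<open>1, 3\<close> one of
degree \<open>4\<close> at position \<open>1\<close>. The other transpositions close the red corners: \<open>attach\<close> followed
by \<open>rot_back\<close> has the cycles \<open>0, 7, 9, 3\<close> and \<open>1, 2, 5\<close>, which give the degrees \<open>8\<close> and \<open>6\<close>.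
The table avoids \<open>attach d = rot m d\<close>, which would create a vertex of degree two.\<close>

definition attach :: "nat \<Rightarrow> nat" where
  "attach d = (if d < 11 then [8, 3, 6, 1, 9, 0, 2, 10, 5, 4, 7] ! d else d)"

definition attach_back :: "nat \<Rightarrow> nat" where
  "attach_back d = (if d < 11 then [5, 3, 6, 1, 9, 8, 2, 10, 0, 4, 7] ! d else d)"

text \<open>The blue corners of a sheet: the positions \<open>0\<close>, \<open>1\<close> form a digon, the positions \<open>2\<close> to \<open>m - 1\<close>
a polygon. Triangles that are neighbours share two corners, so a degree triple can single
out one triangle only if the degrees vary for every colour; the digon serves this purpose
for blue.\<close>

definition rot :: "nat \<Rightarrow> nat \<Rightarrow> nat" where
  "rot m d = (if d < 2 then 1 - d else if Suc d = m then 2 else Suc d)"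

definition rot_back :: "nat \<Rightarrow> nat \<Rightarrow> nat" where
  "rot_back m d = (if d < 2 then 1 - d else if d = 2 then m - 1 else d - 1)"

lemma less_11_cases:
  "(d :: nat) < 11 \<Longrightarrow> d = 0 \<or> d = 1 \<or> d = 2 \<or> d = 3 \<or> d = 4 \<or> d = 5 \<or> d = 6 \<or> d = 7 \<or>
     d = 8 \<or> d = 9 \<or> d = 10"
  by presburger

lemma attach_inverse: "attach_back (attach d) = d" "attach (attach_back d) = d"
proof -
  show "attach_back (attach d) = d"
    by (cases "d < 11") (auto simp: attach_def attach_back_def dest!: less_11_cases)
  show "attach (attach_back d) = d"
    by (cases "d < 11") (auto simp: attach_def attach_back_def dest!: less_11_cases)
qed

lemma attach_less_11: "attach d < 11 \<longleftrightarrow> d < 11" "attach_back d < 11 \<longleftrightarrow> d < 11"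
proof -
  show "attach d < 11 \<longleftrightarrow> d < 11"
    by (cases "d < 11") (auto simp: attach_def dest!: less_11_cases)
  show "attach_back d < 11 \<longleftrightarrow> d < 11"
    by (cases "d < 11") (auto simp: attach_back_def dest!: less_11_cases)
qed

lemma attach_neq: "d < 11 \<Longrightarrow> attach d \<noteq> d"
  by (auto simp: attach_def dest!: less_11_cases)

lemma attach_outside: "\<not> d < 11 \<Longrightarrow> attach d = d" "\<not> d < 11 \<Longrightarrow> attach_back d = d"
  by (simp_all add: attach_def attach_back_def)

lemma rot_inverse:
  assumes "11 \<le> m" "d < m"
  shows "rot_back m (rot m d) = d" "rot m (rot_back m d) = d"
  using assms by (auto simp: rot_def rot_back_def)

lemma rot_less:
  assumes "11 \<le> m" "d < m"
  shows "rot m d < m" "rot_back m d < m"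
  using assms by (auto simp: rot_def rot_back_def)

lemma rot_neq:
  assumes "11 \<le> m" "d < m"
  shows "rot m d \<noteq> d"
  using assms unfolding rot_def by presburger

lemma rot_neq_attach:
  assumes "11 \<le> m" "d < m"
  shows "rot m d \<noteq> attach d"
proof (cases "d < 11")
  case True
  then show ?thesis
    using assms by (auto simp: rot_def attach_def dest!: less_11_cases)
next
  case False
  then show ?thesis
    using rot_neq[OF assms] by (simp add: attach_def)
qed

lemma back_neq:
  assumes "11 \<le> m" "d < m"
  shows "rot_back m d \<noteq> d" "rot_back m d \<noteq> attach_back d" "d < 11 \<Longrightarrow> attach_back d \<noteq> d"
proof -
  show "rot_back m d \<noteq> d"
    using rot_neq[OF assms] rot_inverse[OF assms] by auto
  have "attach_back d < m"
    using assms attach_less_11(2)[of d] attach_outside(2)[of d] by (cases "d < 11") auto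
  then show "rot_back m d \<noteq> attach_back d"
    using rot_neq_attach[OF assms(1), of "attach_back d"] rot_inverse[OF assms] attach_inverse[of d]
    by auto
  show "attach_back d \<noteq> d" if "d < 11"
    using attach_neq[OF that] attach_inverse[of d] by auto
qed

text \<open>One sheet of triangles \<open>(h, d, s)\<close>, with position \<open>d\<close> and side \<open>s\<close>, is laid out for every group
element \<open>h\<close>. Red edges join the two sides of a position, green edges follow \<open>rot\<close>, and blue
edges follow \<open>attach\<close> and multiply \<open>h\<close> from the right by the voltage of the position. Voltages
are trivial on the first eleven positions and run through \<open>S - {\<one>}\<close> on the others. The latter
positions are fixed by \<open>attach\<close>, so a voltage \<open>\<one>\<close> there would make a blue and a red edge
join the same triangles; hence the list \<open>es\<close> omits \<open>\<one>\<close>.\<close>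

locale voltage_gluing = group G for G :: "('a, 'b) monoid_scheme" (structure) +
  fixes S :: "'a set" and es :: "'a list"
  assumes finite_G: "finite (carrier G)" and S: "S \<subseteq> carrier G"
    and generates: "generate G S = carrier G" and es: "set es = S - {\<one>}"
begin

definition sheet_size :: nat where
  "sheet_size = 11 + length es"

definition volt :: "nat \<Rightarrow> 'a" where
  "volt d = (if d < 11 then \<one> else es ! (d - 11))"

definition T :: "('a \<times> nat \<times> bool) set" where
  "T = carrier G \<times> {..<sheet_size} \<times> UNIV"

fun glue :: "colour \<Rightarrow> 'a \<times> nat \<times> bool \<Rightarrow> 'a \<times> nat \<times> bool" where
  "glue Red (h, d, s) = (h, d, \<not> s)"
| "glue Green (h, d, s) = (h, (if s then rot sheet_size d else rot_back sheet_size d), \<not> s)"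
| "glue Blue (h, d, s) =
     (if s then (h \<otimes> volt d, attach d, False) else (h \<otimes> inv (volt d), attach_back d, True))"

lemma sheet_size_ge: "11 \<le> sheet_size"
  by (simp add: sheet_size_def)

lemma volt_attach: "volt (attach d) = volt d" "volt (attach_back d) = volt d"
  using attach_less_11[of d] attach_outside[of d] by (auto simp: volt_def)

lemma attach_less: "d < sheet_size \<Longrightarrow> attach d < sheet_size" "d < sheet_size \<Longrightarrow> attach_back d < sheet_size"
  using attach_less_11[of d] attach_outside[of d] sheet_size_ge by (cases "d < 11"; simp)+

lemma volt_outside:
  assumes "\<not> d < 11" "d < sheet_size"
  shows "volt d \<in> S" "volt d \<noteq> \<one>"
proof -
  have "volt d \<in> set es"
    using assms by (simp add: volt_def sheet_size_def)
  then show "volt d \<in> S" "volt d \<noteq> \<one>"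
    using es by auto
qed

lemma volt_closed [simp]: "d < sheet_size \<Longrightarrow> volt d \<in> carrier G"
  using volt_outside(1)[of d] S by (cases "d < 11") (auto simp: volt_def)

lemma mult_neq:
  assumes "h \<in> carrier G" "g \<in> carrier G" "g \<noteq> \<one>"
  shows "h \<otimes> g \<noteq> h" "h \<otimes> inv g \<noteq> h"
proof -
  have "inv g \<noteq> \<one>"
    using assms inv_inv inv_one by metis
  then show "h \<otimes> g \<noteq> h" "h \<otimes> inv g \<noteq> h"
    using assms by (simp_all add: r_cancel_one')
qed

lemma Blue_neq_Red:
  assumes "(h, d, s) \<in> T"
  shows "glue Blue (h, d, s) \<noteq> (h, d, \<not> s)"
proof (cases "d < 11")
  case True
  then show ?thesis
    using attach_neq[of d] back_neq(3)[OF sheet_size_ge, of d] assms by (auto simp: T_def)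
next
  case False
  then show ?thesis
    using assms mult_neq[of h "volt d"] volt_outside[of d] by (auto simp: T_def)
qed

sublocale coloured_gluing T glue "\<lambda>t. snd (snd t)"
proof
  show "finite T" "T \<noteq> {}"
    using finite_G sheet_size_ge by (auto simp: T_def lessThan_empty_iff)
  fix t :: "'a \<times> nat \<times> bool" and i j :: colour
  assume "t \<in> T"
  obtain h d s where t: "t = (h, d, s)"
    by (cases t) auto
  have h: "h \<in> carrier G" and d: "d < sheet_size"
    using \<open>t \<in> T\<close> by (auto simp: t T_def)
  show "glue i t \<in> T"
    using h d rot_less[OF sheet_size_ge d] attach_less[OF d] by (cases i) (auto simp: t T_def)
  show "glue i (glue i t) = t"
    using h d rot_inverse[OF sheet_size_ge d] attach_inverse[of d]
    by (cases i) (auto simp: t volt_attach m_assoc)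
  show "snd (snd (glue i t)) \<longleftrightarrow> \<not> snd (snd t)"
    by (cases i) (auto simp: t)
  have GR: "glue Green t \<noteq> glue Red t"
    using rot_neq[OF sheet_size_ge d] back_neq(1)[OF sheet_size_ge d] by (auto simp: t)
  have BR: "glue Blue t \<noteq> glue Red t"
    using Blue_neq_Red \<open>t \<in> T\<close> by (auto simp: t)
  have BG: "glue Blue t \<noteq> glue Green t"
    using rot_neq_attach[OF sheet_size_ge d] back_neq(2)[OF sheet_size_ge d] by (auto simp: t)
  show "glue i t \<noteq> glue j t" if "i \<noteq> j"
    using that GR BR BG by (cases i; cases j) auto
qed

definition base :: "'a \<times> nat \<times> bool" where
  "base = (\<one>, 0, True)"

text \<open>Gluing changes group elements from the right only, so it commutes with these maps.\<close>

definition left_mult :: "'a \<Rightarrow> 'a \<times> nat \<times> bool \<Rightarrow> 'a \<times> nat \<times> bool" where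
  "left_mult g = (\<lambda>(h, d, s). (g \<otimes> h, d, s))"

lemma left_mult_glue:
  assumes "g \<in> carrier G" "t \<in> T"
  shows "left_mult g t \<in> T" "left_mult g (glue i t) = glue i (left_mult g t)"
proof -
  obtain h d s where t: "t = (h, d, s)"
    by (cases t) auto
  have "h \<in> carrier G" "d < sheet_size"
    using assms(2) by (auto simp: t T_def)
  then show "left_mult g t \<in> T" "left_mult g (glue i t) = glue i (left_mult g t)"
    using assms(1) by (cases i; auto simp: t T_def left_mult_def m_assoc)+
qed

lemma rot_gadget:
  "rot sheet_size 0 = 1" "rot sheet_size (Suc 0) = 0" "rot_back sheet_size 0 = 1" "rot_back sheet_size (Suc 0) = 0" 
  "rot_back sheet_size 8 = 7" "rot_back sheet_size 10 = 9" "rot_back sheet_size 4 = 3" "rot_back sheet_size 3 = 2" "rot_back sheet_size 6 = 5"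
  by (simp_all add: rot_def rot_back_def)

lemma volt_gadget: "d < 11 \<Longrightarrow> volt d = \<one>"
  by (simp add: volt_def)

lemma attach_gadget:
  "attach 0 = 8" "attach 8 = 5" "attach 5 = 0" "attach (Suc 0) = 3" "attach 3 = 1" "attach 2 = 6" "attach 6 = 2"
  "attach 7 = 10" "attach 10 = 7" "attach 9 = 4" "attach 4 = 9"
  by (simp_all add: attach_def)

lemmas gadget = rot_gadget attach_gadget volt_gadget

text \<open>These corners only involve positions with trivial voltage, so their degrees can be read off
by walking around them within the sheet \<open>h\<close>.\<close>

lemma orbits_0:
  assumes h: "h \<in> carrier G"
  shows "card (orb Blue (h, 0, True)) = 4" "card (orb Green (h, 0, True)) = 6"
    "card (orb Red (h, 0, True)) = 8"
proof -
  have t: "(h, 0, True) \<in> T"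
    using h sheet_size_ge by (simp add: T_def)
  have others: "\<forall>c. c \<noteq> Blue \<longrightarrow> c = Green \<or> c = Red" "\<forall>c. c \<noteq> Green \<longrightarrow> c = Blue \<or> c = Red"
    "\<forall>c. c \<noteq> Red \<longrightarrow> c = Blue \<or> c = Green"
    using colour.exhaust by blast+
  have "orb Blue (h, 0, True) = walk Green Red (h, 0, True) ` {..<4}"
    by (rule orb_eq_walk[OF t _ _ others(1)]) (simp_all add: gadget h)
  then show "card (orb Blue (h, 0, True)) = 4"
    by (simp add: lessThan_nat_numeral lessThan_Suc gadget h)
  have "orb Green (h, 0, True) = walk Blue Red (h, 0, True) ` {..<6}"
    by (rule orb_eq_walk[OF t _ _ others(2)]) (simp_all add: gadget h)
  then show "card (orb Green (h, 0, True)) = 6"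
    by (simp add: lessThan_nat_numeral lessThan_Suc gadget h)
  have "orb Red (h, 0, True) = walk Blue Green (h, 0, True) ` {..<8}"
    by (rule orb_eq_walk[OF t _ _ others(3)]) (simp_all add: gadget h)
  then show "card (orb Red (h, 0, True)) = 8"
    by (simp add: lessThan_nat_numeral lessThan_Suc gadget h)
qed

lemma orbits_1:
  assumes h: "h \<in> carrier G"
  shows "card (orb Green (h, 1, True)) = 4" "card (orb Red (h, 1, True)) = 6"
proof -
  have t: "(h, 1, True) \<in> T"
    using h sheet_size_ge by (simp add: T_def)
  have others: "\<forall>c. c \<noteq> Green \<longrightarrow> c = Blue \<or> c = Red"
    "\<forall>c. c \<noteq> Red \<longrightarrow> c = Blue \<or> c = Green"
    using colour.exhaust by blast+
  have "orb Green (h, 1, True) = walk Blue Red (h, 1, True) ` {..<4}"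
    by (rule orb_eq_walk[OF t _ _ others(1)]) (simp_all add: gadget h)
  then show "card (orb Green (h, 1, True)) = 4"
    by (simp add: lessThan_nat_numeral lessThan_Suc gadget h)
  have "orb Red (h, 1, True) = walk Blue Green (h, 1, True) ` {..<6}"
    by (rule orb_eq_walk[OF t _ _ others(2)]) (simp_all add: gadget h)
  then show "card (orb Red (h, 1, True)) = 6"
    by (simp add: lessThan_nat_numeral lessThan_Suc gadget h)
qed

lemma orb_glue: "t \<in> T \<Longrightarrow> i \<noteq> k \<Longrightarrow> orb k (glue i t) = orb k t"
  using orb_eq[OF orb_step[OF orb_refl]] by blast

lemma polygon:
  assumes h: "h \<in> carrier G" and d: "2 \<le> d" "d < sheet_size"
  shows "(h, d, s) \<in> orb Blue (h, 2, True)"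
proof -
  have "(h, d, True) \<in> orb Blue (h, 2, True)"
    using d
  proof (induction d rule: dec_induct)
    case (step d)
    then have IH: "(h, d, True) \<in> orb Blue (h, 2, True)" and d: "d < sheet_size" "2 \<le> d" "Suc d < sheet_size"
      by auto
    have t: "(h, d, True) \<in> T" "(h, Suc d, False) \<in> T"
      using h d by (simp_all add: T_def)
    have "glue Green (h, d, True) = (h, Suc d, False)"
      using d by (simp add: rot_def)
    then have "(h, Suc d, False) \<in> orb Blue (h, 2, True)"
      using orb_step[OF IH t(1), of Green] by simp
    then show ?case
      using orb_step[OF _ t(2), of Blue _ Red] by simp
  qed simp
  moreover have "(h, d, True) \<in> T"
    using h d by (simp add: T_def)
  ultimately show ?thesis
    using orb_step[of "(h, d, True)" Blue "(h, 2, True)" Red] by (cases s) auto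
qed

text \<open>The polygon has at least nine positions. Thus its centre has a degree that exceeds
all three degrees at the base triangle.\<close>

lemma card_polygon:
  assumes h: "h \<in> carrier G" and d: "2 \<le> d" "d < sheet_size"
  shows "9 \<le> card (orb Blue (h, d, s))"
proof -
  have "(h, 2, True) \<in> T"
    using h d by (simp add: T_def)
  have "(\<lambda>c. (h, c, True)) ` {2..<11} \<subseteq> orb Blue (h, 2, True)"
    using polygon[OF h] sheet_size_ge by auto
  then have "card ((\<lambda>c. (h, c, True)) ` {2..<11 :: nat}) \<le> card (orb Blue (h, 2, True))"
    using finite_orb[OF \<open>(h, 2, True) \<in> T\<close>] by (rule card_mono[rotated])
  moreover have "card ((\<lambda>c. (h, c, True)) ` {2..<11 :: nat}) = 9"
    by (subst card_image) (auto simp: inj_on_def)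
  ultimately show ?thesis
    using orb_eq[OF polygon[OF h d]] by simp
qed

lemma degrees_base:
  "card (orb k base) = (case k of Blue \<Rightarrow> 4 | Green \<Rightarrow> 6 | Red \<Rightarrow> 8)"
  using orbits_0[OF one_closed] by (cases k) (simp_all add: base_def)

text \<open>Every triangle has a blue corner. Away from the digon its degree is at least \<open>9\<close>. Of the
four triangles at a digon, listed with the degrees of their red, green and blue corners,
\<open>(h, 0, True)\<close> has \<open>8, 6, 4\<close>, \<open>(h, 0, False)\<close> has \<open>6, 6, 4\<close>, \<open>(h, 1, True)\<close> has \<open>6, 4, 4\<close>
and \<open>(h, 1, False)\<close> has \<open>8, 4, 4\<close>.\<close>

lemma base_recognised:
  assumes t: "t \<in> T"
    and range: "range (\<lambda>k. card (orb k t)) = range (\<lambda>k. card (orb k base))"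
  shows "\<exists>g\<in>carrier G. t = left_mult g base"
proof -
  obtain h d s where t_eq: "t = (h, d, s)"
    by (cases t) auto
  have h: "h \<in> carrier G" and d: "d < sheet_size"
    using t by (auto simp: t_eq T_def)
  have range': "{card (orb Red t), card (orb Green t), card (orb Blue t)} = {8, 6, 4}"
    using range by (simp add: UNIV_colour degrees_base)
  have degrees: "8 \<in> {card (orb Red t), card (orb Green t), card (orb Blue t)}"
    "6 \<in> {card (orb Red t), card (orb Green t), card (orb Blue t)}"
    "card (orb Blue t) \<in> {8, 6, 4}"
    using range' by blast+
  have T: "(h, 0, s) \<in> T" "(h, 1, s) \<in> T" for s
    using h sheet_size_ge by (simp_all add: T_def)
  have "d = 0 \<and> s"
  proof (rule ccontr)
    assume "\<not> (d = 0 \<and> s)"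
    then consider "2 \<le> d" | "d = 0" "\<not> s" | "d = 1" "s" | "d = 1" "\<not> s"
      by linarith
    then show False
    proof cases
      case 1
      then have "9 \<le> card (orb Blue t)"
        using card_polygon[OF h _ d] by (simp add: t_eq)
      then show False
        using degrees by auto
    next
      case 2
      then have "orb Red t = orb Red (h, 1, True)" "orb Green t = orb Green (h, 0, True)"
        "orb Blue t = orb Blue (h, 0, True)"
        using orb_glue[OF T(1)[of False], of Green Red] orb_glue[OF T(1)[of True], of Red]
        by (simp_all add: t_eq gadget)
      then show False
        using degrees orbits_0[OF h] orbits_1[OF h] by auto
    next
      case 3
      then have "orb Blue t = orb Blue (h, 0, False)"
        using orb_glue[OF T(2)[of True], of Green Blue] by (simp add: t_eq gadget)
      also have "\<dots> = orb Blue (h, 0, True)"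
        using orb_glue[OF T(1)[of True], of Red Blue] by simp
      finally show False
        using degrees orbits_0[OF h] orbits_1[OF h] 3 by (auto simp: t_eq)
    next
      case 4
      then have "orb Red t = orb Red (h, 0, True)" "orb Green t = orb Green (h, 1, True)"
        "orb Blue t = orb Blue (h, 0, True)"
        using orb_glue[OF T(2)[of False], of Green] orb_glue[OF T(2)[of True], of Red Green]
        by (simp_all add: t_eq gadget)
      then show False
        using degrees orbits_0[OF h] orbits_1[OF h] by auto
    qed
  qed
  then have "t = left_mult h base"
    using h by (simp add: t_eq left_mult_def base_def)
  then show ?thesis
    using h by blast
qed

text \<open>The blue edge at position \<open>0\<close> leads from the digon to position \<open>8\<close> of the polygon.\<close>

lemma connected_sheet:
  assumes h: "h \<in> carrier G" and d: "d < sheet_size"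
  shows "((h, 0, True), (h, d, s)) \<in> connection"
proof -
  have T: "(h, c, r) \<in> T" if "c < sheet_size" for c r
    using h that by (simp add: T_def)
  have small: "0 < sheet_size" "1 < sheet_size" "8 < sheet_size"
    using sheet_size_ge by auto
  show ?thesis
  proof (cases "2 \<le> d")
    case True
    have "((h, 0, True), (h, 8, False)) \<in> connection"
      using connection_step[OF T[OF small(1)], of True Blue] h by (simp add: gadget)
    moreover have "(h, d, s) \<in> orb Blue (h, 8, False)"
      using polygon[OF h True d] orb_eq[OF polygon[OF h _ small(3)]] by simp
    ultimately show ?thesis
      using orb_connection connection_trans by blast
  next
    case False
    have "(h, d, s) \<in> {(h, 0, True), (h, 0, False), (h, 1, False), (h, 1, True)}"
      using False by auto
    moreover have "((h, 0, True), (h, 0, True)) \<in> connection"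
      by (simp add: connection_def)
    moreover have "((h, 0, True), (h, 0, False)) \<in> connection"
      using connection_step[OF T[OF small(1)], of True Red] by simp
    moreover have step: "((h, 0, True), (h, 1, False)) \<in> connection"
      using connection_step[OF T[OF small(1)], of True Green] by (simp add: gadget)
    moreover have "((h, 0, True), (h, 1, True)) \<in> connection"
      using connection_trans[OF step] connection_step[OF T[OF small(2)], of False Red] by simp
    ultimately show ?thesis
      by auto
  qed
qed

text \<open>The path runs from the base position of sheet \<open>h\<close> to the position that carries the voltage
\<open>g\<close>, crosses its blue edge, and returns to the base position in the sheet \<open>h \<otimes> g\<close>.\<close>

lemma sheets_adjacent:
  assumes h: "h \<in> carrier G" and g: "g \<in> S"
  shows "((h, 0, True), (h \<otimes> g, 0, True)) \<in> connection"
proof (cases "g = \<one>")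
  case True
  then show ?thesis
    using h by (simp add: connection_def)
next
  case False
  then obtain i where i: "i < length es" "g = es ! i"
    using g es by (metis Diff_iff empty_iff in_set_conv_nth insert_iff)
  have d: "11 + i < sheet_size" and hg: "h \<otimes> g \<in> carrier G"
    using i h g S by (auto simp: sheet_size_def)
  have "((h, 11 + i, True), (h \<otimes> g, 11 + i, False)) \<in> connection"
    using connection_step[of "(h, 11 + i, True)" Blue] h d i
    by (simp add: T_def volt_def attach_def)
  moreover have "((h \<otimes> g, 11 + i, False), (h \<otimes> g, 0, True)) \<in> connection"
    using symD[OF sym_connection connected_sheet[OF hg d]] .
  ultimately show ?thesis
    using connected_sheet[OF h d] connection_trans by blast
qed

lemma sheets_connected:
  assumes "g \<in> generate G S" and "h \<in> carrier G"
  shows "((h, 0, True), (h \<otimes> g, 0, True)) \<in> connection"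
  using assms
proof (induction g arbitrary: h rule: generate.induct)
  case one
  then show ?case
    by (simp add: connection_def)
next
  case (incl g)
  then show ?case
    by (intro sheets_adjacent)
next
  case (inv g)
  then have "g \<in> carrier G"
    using S by auto
  then show ?case
    using inv sheets_adjacent[of "h \<otimes> inv g" g] symD[OF sym_connection] by (simp add: m_assoc)
next
  case (eng g g')
  then have "g \<in> carrier G" "g' \<in> carrier G"
    using generates by auto
  then show ?case
    using eng.IH(1)[OF eng.prems] eng.IH(2)[of "h \<otimes> g"] eng.prems connection_trans
    by (simp add: m_assoc)
qed

lemma connected:
  assumes "t \<in> T"
  shows "(base, t) \<in> connection"
proof -
  obtain h d s where t: "t = (h, d, s)" "h \<in> carrier G" "d < sheet_size"
    using assms by (auto simp: T_def)
  have "((\<one>, 0, True), (h, 0, True)) \<in> connection"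
    using sheets_connected[of h \<one>] t(2) generates by simp
  then show ?thesis
    using connected_sheet[OF t(2,3)] connection_trans unfolding t(1) base_def by blast
qed

lemma surface_with_automorphism_group:
  "\<exists>X :: nat incidence_structure. simplicial_surface X \<and> Aut X \<cong> G"
proof -
  obtain F :: "'a \<times> nat \<times> bool \<Rightarrow> nat" and E V
    where "coloured_surface T glue (\<lambda>t. snd (snd t)) F E V"
    using nat_coloured_surface by blast
  then interpret coloured_surface T glue "\<lambda>t. snd (snd t)" F E V .
  have "Aut X \<cong> G"
  proof (rule Aut_iso[where s = base and \<tau> = left_mult])
    show "group G" ..
    show "base \<in> T"
      using sheet_size_ge by (simp add: base_def T_def)
    show "symmetry (left_mult g)" if "g \<in> carrier G" for g
      using left_mult_glue[OF that] by (simp add: symmetry_def)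
    show "left_mult (g \<otimes> h) t = left_mult g (left_mult h t)"
      if "g \<in> carrier G" "h \<in> carrier G" "t \<in> T" for g h t
      using that by (auto simp: left_mult_def T_def m_assoc)
    show "left_mult \<one> t = t" if "t \<in> T" for t
      using that by (auto simp: left_mult_def T_def)
    show "g = h" if "g \<in> carrier G" "h \<in> carrier G" "left_mult g base = left_mult h base" for g h
      using that by (simp add: left_mult_def base_def)
    show "inj (\<lambda>k. card (orb k base))"
      unfolding inj_def degrees_base by (auto split: colour.splits)
  qed (auto intro: connected base_recognised)
  then show ?thesis
    using surface by blast
qed

end

section \<open>Groups as automorphism groups of surfaces\<close>

theorem theorem7p1:
  fixes G :: "('a, 'b) monoid_scheme" and S :: "'a set"
  assumes "group G" and "finite (carrier G)"
    and "S \<subseteq> carrier G" and "generate G S = carrier G"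
  shows "\<exists>X :: nat incidence_structure. simplicial_surface X \<and> Aut X \<cong> G"
proof -
  have "finite (S - {\<one>\<^bsub>G\<^esub>})"
    using assms(2,3) finite_subset by blast
  then obtain es where "set es = S - {\<one>\<^bsub>G\<^esub>}"
    using finite_list by blast
  then interpret voltage_gluing G S es
    using assms by (simp add: voltage_gluing_def voltage_gluing_axioms_def)
  show ?thesis
    by (rule surface_with_automorphism_group)
qed

end
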